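(* Let $z_n\to z$ in $Y$ and let $S\colon U\to Y$ be weak-to-weak continuous, i.e., $u_i\rightharpoonup u$ in $U$ implies $S(u_i)\rightharpoonup S(u)$ in $Y$. Then, with respect to weak convergence in $U$, $$\Gamma\text{-}\lim_{n\to\infty}\mathcal E^{z_n}=\mathcal E^z.$$
   Context: $\Omega\subset\mathbb R^n$ is a bounded open domain, $m\ge 2$, $U=L^2(\Omega;\mathbb R^m)$, $Y$ is a (real) Hilbert space, and $S\colon U\to Y$ is a (possibly nonlinear) operator. $\mathcal M\subset\mathbb R^m$ is a finite set and $g\colon\mathbb R^m\to\mathbb R\cup\{\infty\}$ is proper, convex, and lower semi-continuous with $\operatorname{dom} g=\operatorname{co}\mathcal M$ (the convex hull of $\mathcal M$). For $z\in Y$, $\mathcal E^z(u)=\frac12\|S(u)-z\|_Y^2+\int_\Omega g(u(x))\,\mathrm dx$ for $u\in U$. $\Gamma$-convergence is sequential: $\Gamma\text{-}\lim_n\mathcal E^{z_n}=\mathcal E^z$ with respect to weak convergence means (a) $\liminf_n\mathcal E^{z_n}(u_n)\ge\mathcal E^z(u)$ whenever $u_n\rightharpoonup u$ in $U$; (b) for every $u\in U$ there is a sequence $u_n\rightharpoonup u$ with $\limsup_n\mathcal E^{z_n}(u_n)\le\mathcal E^z(u)$. Weak-to-weak continuity is understood for sequences. *)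

theory Defs
  imports "HOL-Analysis.Analysis"
begin

section \<open>The space of square integrable vector fields\<close>

text \<open>
  Elements of \<open>L\<^sup>2(\<Omega>; \<real>\<^sup>m)\<close> are represented by functions on the whole space of which only the
  restriction to \<open>\<Omega>\<close> matters; two representatives denote the same element iff they agree almost
  everywhere on \<open>\<Omega>\<close>. Operators on \<open>L\<^sup>2\<close> are functions on representatives that respect this
  equivalence.
\<close>

definition L2 :: "(real^'n) set \<Rightarrow> (real^'n \<Rightarrow> real^'m) set" where
  "L2 \<Omega> = {u. u \<in> borel_measurable (lebesgue_on \<Omega>) \<and>
              integrable (lebesgue_on \<Omega>) (\<lambda>x. (norm (u x))\<^sup>2)}"

definition L2_norm :: "(real^'n) set \<Rightarrow> (real^'n \<Rightarrow> real^'m) \<Rightarrow> real" where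
  "L2_norm \<Omega> u = sqrt (\<integral>x. (norm (u x))\<^sup>2 \<partial>lebesgue_on \<Omega>)"

definition L2_operator :: "(real^'n) set \<Rightarrow> ((real^'n \<Rightarrow> real^'m) \<Rightarrow> 'y) \<Rightarrow> bool" where
  "L2_operator \<Omega> S \<longleftrightarrow>
     (\<forall>u\<in>L2 \<Omega>. \<forall>v\<in>L2 \<Omega>. (AE x in lebesgue_on \<Omega>. u x = v x) \<longrightarrow> S u = S v)"

text \<open>
  Linearity and boundedness together force a functional to respect almost everywhere equality,
  so these are exactly the elements of the dual space.
\<close>

definition L2_dual :: "(real^'n) set \<Rightarrow> ((real^'n \<Rightarrow> real^'m) \<Rightarrow> real) set" where
  "L2_dual \<Omega> = {f. (\<forall>u\<in>L2 \<Omega>. \<forall>v\<in>L2 \<Omega>. f (\<lambda>x. u x + v x) = f u + f v) \<and>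
                   (\<forall>c. \<forall>u\<in>L2 \<Omega>. f (\<lambda>x. c *\<^sub>R u x) = c * f u) \<and>
                   (\<exists>C. \<forall>u\<in>L2 \<Omega>. \<bar>f u\<bar> \<le> C * L2_norm \<Omega> u)}"

section \<open>Weak convergence of sequences\<close>

definition L2_weak_conv ::
    "(real^'n) set \<Rightarrow> (nat \<Rightarrow> real^'n \<Rightarrow> real^'m) \<Rightarrow> (real^'n \<Rightarrow> real^'m) \<Rightarrow> bool" where
  "L2_weak_conv \<Omega> us u \<longleftrightarrow> (\<forall>i. us i \<in> L2 \<Omega>) \<and> u \<in> L2 \<Omega> \<and>
     (\<forall>f\<in>L2_dual \<Omega>. (\<lambda>i. f (us i)) \<longlonglongrightarrow> f u)"

definition weak_conv :: "(nat \<Rightarrow> 'y::real_normed_vector) \<Rightarrow> 'y \<Rightarrow> bool" where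
  "weak_conv ys y \<longleftrightarrow> (\<forall>f :: 'y \<Rightarrow> real. bounded_linear f \<longrightarrow> (\<lambda>i. f (ys i)) \<longlonglongrightarrow> f y)"

definition weak_to_weak_continuous ::
    "(real^'n) set \<Rightarrow> ((real^'n \<Rightarrow> real^'m) \<Rightarrow> 'y::real_normed_vector) \<Rightarrow> bool" where
  "weak_to_weak_continuous \<Omega> S \<longleftrightarrow>
     (\<forall>us u. L2_weak_conv \<Omega> us u \<longrightarrow> weak_conv (\<lambda>i. S (us i)) (S u))"

section \<open>Extended real valued functions\<close>

definition proper_fun :: "('a \<Rightarrow> ereal) \<Rightarrow> bool" where
  "proper_fun g \<longleftrightarrow> (\<forall>v. g v \<noteq> -\<infinity>) \<and> (\<exists>v. g v \<noteq> \<infinity>)"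

definition convex_fun :: "('a::real_vector \<Rightarrow> ereal) \<Rightarrow> bool" where
  "convex_fun g \<longleftrightarrow>
     (\<forall>v w. \<forall>t\<in>{0<..<1}. g ((1 - t) *\<^sub>R v + t *\<^sub>R w) \<le> ereal (1 - t) * g v + ereal t * g w)"

definition lsc_fun :: "('a::topological_space \<Rightarrow> ereal) \<Rightarrow> bool" where
  "lsc_fun g \<longleftrightarrow> (\<forall>v. g v \<le> Liminf (at v) g)"

definition effective_domain :: "('a \<Rightarrow> ereal) \<Rightarrow> 'a set" where
  "effective_domain g = {v. g v < \<infinity>}"

text \<open>
  Extended Lebesgue integral as the difference of the integrals of the positive and negative
  parts; \<^const>\<open>e2ennreal\<close> truncates negative values to zero. It is meaningful whenever one of the
  two integrals is finite.
\<close>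

definition ereal_integral :: "'a measure \<Rightarrow> ('a \<Rightarrow> ereal) \<Rightarrow> ereal" where
  "ereal_integral M h =
     enn2ereal (\<integral>\<^sup>+x. e2ennreal (h x) \<partial>M) - enn2ereal (\<integral>\<^sup>+x. e2ennreal (- h x) \<partial>M)"

section \<open>The functional and Gamma-convergence\<close>

definition energy ::
    "(real^'n) set \<Rightarrow> ((real^'n \<Rightarrow> real^'m) \<Rightarrow> 'y::real_normed_vector) \<Rightarrow> (real^'m \<Rightarrow> ereal) \<Rightarrow>
     'y \<Rightarrow> (real^'n \<Rightarrow> real^'m) \<Rightarrow> ereal" where
  "energy \<Omega> S g z u =
     ereal (1 / 2 * (norm (S u - z))\<^sup>2) + ereal_integral (lebesgue_on \<Omega>) (\<lambda>x. g (u x))"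

text \<open>
  Sequential Gamma-convergence on \<open>X\<close> with respect to a notion \<open>conv\<close> of convergence of sequences.
\<close>

definition is_Gamma_limit ::
    "'u set \<Rightarrow> ((nat \<Rightarrow> 'u) \<Rightarrow> 'u \<Rightarrow> bool) \<Rightarrow> (nat \<Rightarrow> 'u \<Rightarrow> ereal) \<Rightarrow> ('u \<Rightarrow> ereal) \<Rightarrow> bool" where
  "is_Gamma_limit X conv F F0 \<longleftrightarrow>
     (\<forall>us u. (\<forall>n. us n \<in> X) \<longrightarrow> u \<in> X \<longrightarrow> conv us u \<longrightarrow> F0 u \<le> liminf (\<lambda>n. F n (us n))) \<and>
     (\<forall>u\<in>X. \<exists>us. (\<forall>n. us n \<in> X) \<and> conv us u \<and> limsup (\<lambda>n. F n (us n)) \<le> F0 u)"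

end

theory Submission
  imports Defs
begin

text \<open>
  Strong convergence of the data \<open>z\<^sub>n\<close> only perturbs the tracking term, so a constant sequence
  recovers the energy of every \<open>u\<close>. What has to be proved is the lower bound, and it splits into
  two weak lower semicontinuity statements, one for each term of the energy.

  For the tracking term, \<open>S u\<^sub>n - z\<^sub>n\<close> converges weakly to \<open>S u - z\<close>, and half the squared norm is
  a supremum of affine functionals: \<open>\<parallel>y\<parallel>\<^sup>2 / 2 \<ge> \<langle>d, y\<rangle> - \<parallel>d\<parallel>\<^sup>2 / 2\<close> with equality at
  \<open>y = d\<close> (lemma \<open>weak_lsc_half_norm_squared\<close>).

  For the integral term the same idea is applied under the integral. Separating points from the
  epigraph writes \<open>g\<close> as the supremum of countably many affine functions
  (\<open>countable_affine_supremum\<close>), hence as the increasing limit of the maxima \<open>\<phi>\<^sub>k\<close> of the first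
  \<open>k + 1\<close> of them. For fixed \<open>k\<close> and \<open>u\<close>, choosing at each point \<open>x\<close> an affine function that attains
  the maximum at \<open>u(x)\<close> gives bounded measurable fields \<open>p, q\<close> with
  \<open>\<phi>\<^sub>k(w) \<ge> p(x) \<bullet> w + q(x)\<close> for all \<open>w\<close>, and equality at \<open>w = u(x)\<close>
  (\<open>measurable_active_affine\<close>). Integration against \<open>p\<close> is a bounded functional on \<open>L\<^sup>2\<close>, so
  \<open>\<integral>\<phi>\<^sub>k(u\<^sub>n) \<ge> \<integral>p \<bullet> u\<^sub>n + \<integral>q \<longlongrightarrow> \<integral>\<phi>\<^sub>k(u)\<close>. As \<open>\<phi>\<^sub>k \<le> g\<close>, letting \<open>k\<close> tend to infinity by
  monotone convergence proves the claim (\<open>convex_integral_weak_lsc\<close>).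
\<close>

section \<open>Convex lower semicontinuous functions as suprema of affine functions\<close>

lemma closed_epigraph:
  fixes g :: "'a::topological_space \<Rightarrow> ereal"
  assumes "lsc_fun g"
  shows "closed {p :: 'a \<times> real. g (fst p) \<le> ereal (snd p)}"
proof -
  have "open {p :: 'a \<times> real. ereal (snd p) < g (fst p)}"
  proof (rule Topological_Spaces.openI)
    fix p :: "'a \<times> real"
    assume "p \<in> {p. ereal (snd p) < g (fst p)}"
    then obtain t where t: "ereal (snd p) < ereal t" "ereal t < g (fst p)"
      using ereal_dense2[of "ereal (snd p)" "g (fst p)"] by auto
    have "g (fst p) \<le> Liminf (at (fst p)) g"
      using assms by (simp add: lsc_fun_def)
    then have "eventually (\<lambda>w. ereal t < g w) (at (fst p))"
      using t(2) by (simp add: le_Liminf_iff)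
    then obtain U where U: "open U" "fst p \<in> U" "\<And>w. w \<in> U - {fst p} \<Longrightarrow> ereal t < g w"
      unfolding eventually_at_topological by auto
    have "q \<in> {p. ereal (snd p) < g (fst p)}" if "q \<in> U \<times> {..<t}" for q
    proof -
      have "ereal (snd q) < ereal t" "ereal t < g (fst q)"
        using that t(2) U(3) by (cases "fst q = fst p"; auto)+
      then have "ereal (snd q) < g (fst q)"
        by (rule less_trans)
      then show ?thesis by simp
    qed
    moreover have "open (U \<times> {..<t})" "p \<in> U \<times> {..<t}"
      using U t(1) by (auto intro: open_Times simp: mem_Times_iff)
    ultimately show "\<exists>T. open T \<and> p \<in> T \<and> T \<subseteq> {p. ereal (snd p) < g (fst p)}"
      by blast
  qed
  moreover have "- {p :: 'a \<times> real. g (fst p) \<le> ereal (snd p)} = {p. ereal (snd p) < g (fst p)}"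
    by auto
  ultimately show ?thesis
    by (simp add: closed_def)
qed

lemma convex_epigraph:
  fixes g :: "'a::real_vector \<Rightarrow> ereal"
  assumes "convex_fun g"
  shows "convex {p :: 'a \<times> real. g (fst p) \<le> ereal (snd p)}"
  unfolding convex_alt
proof safe
  fix v w :: 'a and r s t :: real
  assume le: "g (fst (v, r)) \<le> ereal (snd (v, r))" "g (fst (w, s)) \<le> ereal (snd (w, s))"
    and t: "0 \<le> t" "t \<le> 1"
  show "g (fst ((1 - t) *\<^sub>R (v, r) + t *\<^sub>R (w, s)))
          \<le> ereal (snd ((1 - t) *\<^sub>R (v, r) + t *\<^sub>R (w, s)))"
  proof (cases "t = 0 \<or> t = 1")
    case False
    with t have "t \<in> {0<..<1}" by auto
    then have "g ((1 - t) *\<^sub>R v + t *\<^sub>R w) \<le> ereal (1 - t) * g v + ereal t * g w"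
      using assms by (simp add: convex_fun_def)
    also have "\<dots> \<le> ereal (1 - t) * ereal r + ereal t * ereal s"
      using le t by (intro add_mono ereal_mult_left_mono) auto
    finally show ?thesis by simp
  qed (use le in auto)
qed

text \<open>
  The epigraph is closed and convex, so a hyperplane \<open>p \<bullet> w + q s = c\<close> separates it strictly from
  \<open>(v, r)\<close>. Since the epigraph is unbounded upwards, \<open>q \<ge> 0\<close>. If \<open>q > 0\<close>, solving for \<open>s\<close> yields the
  affine minorant. A vertical hyperplane, \<open>q = 0\<close>, can only occur when \<open>g v = \<infinity>\<close>.
\<close>

lemma affine_minorant_above:
  fixes g :: "'a::euclidean_space \<Rightarrow> ereal"
  assumes "proper_fun g" "convex_fun g" "lsc_fun g" and r: "ereal r < g v"
  shows "\<exists>a b. (\<forall>w. ereal (a \<bullet> w + b) \<le> g w) \<and> r < a \<bullet> v + b"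
proof -
  let ?E = "{p :: 'a \<times> real. g (fst p) \<le> ereal (snd p)}"
  have sep: "\<exists>p q c. p \<bullet> v' + q * r' < c \<and> (\<forall>w s. g w \<le> ereal s \<longrightarrow> c < p \<bullet> w + q * s)"
    if "ereal r' < g v'" for r' v'
  proof -
    have "(v', r') \<notin> ?E"
      using that by auto
    then obtain pq c where "inner pq (v', r') < c" "\<forall>x\<in>?E. c < inner pq x"
      using separating_hyperplane_closed_point[OF convex_epigraph[OF assms(2)] closed_epigraph[OF assms(3)]]
      by blast
    then show ?thesis
      by (intro exI[of _ "fst pq"] exI[of _ "snd pq"] exI[of _ c]) (auto simp: inner_prod_def)
  qed
  have dom: "\<exists>s. g w = ereal s" if "g w \<noteq> \<infinity>" for w
    using that assms(1) by (cases "g w") (auto simp: proper_fun_def)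
  have minorant: "ereal ((- (1 / q) *\<^sub>R p) \<bullet> w + c / q) \<le> g w"
    if "0 < q" and H: "\<forall>w s. g w \<le> ereal s \<longrightarrow> c < p \<bullet> w + q * s" for p q c w
  proof (cases "g w = \<infinity>")
    case False
    then obtain s where s: "g w = ereal s" using dom by blast
    then have "c < p \<bullet> w + q * s" using H by simp
    then have "c / q - p \<bullet> w / q \<le> s"
      using \<open>0 < q\<close> by (simp add: field_simps)
    then show ?thesis using s by simp
  qed simp
  obtain v0 s0 where s0: "g v0 = ereal s0"
    using assms(1) dom unfolding proper_fun_def by blast
  have q_nonneg: "0 \<le> q" if H: "\<forall>w s. g w \<le> ereal s \<longrightarrow> c < p \<bullet> w + q * s" for p q c
  proof (rule ccontr)
    assume "\<not> 0 \<le> q"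
    then have q: "q < 0" by simp
    define s where "s = max s0 ((c - p \<bullet> v0) / q)"
    have "q * s \<le> q * ((c - p \<bullet> v0) / q)"
      using q by (intro mult_left_mono_neg) (auto simp: s_def)
    moreover have "g v0 \<le> ereal s" using s0 by (simp add: s_def)
    then have "c < p \<bullet> v0 + q * s" using H by blast
    ultimately show False using q by simp
  qed
  obtain p q c where v: "p \<bullet> v + q * r < c" and H: "\<forall>w s. g w \<le> ereal s \<longrightarrow> c < p \<bullet> w + q * s"
    using sep[OF r] by blast
  show ?thesis
  proof (cases "q = 0")
    case False
    then have q: "0 < q" using q_nonneg[OF H] by simp
    then have "r < (- (1 / q) *\<^sub>R p) \<bullet> v + c / q"
      using v by (simp add: field_simps)
    with minorant[OF q H] show ?thesis by blast
  next
    case True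
    \<comment> \<open>The hyperplane separates \<open>v\<close> from the effective domain. Adding a large multiple \<open>l\<close> of
      \<open>c - p \<bullet> w\<close>, which is negative on the effective domain and positive at \<open>v\<close>, to any affine
      minorant keeps it below \<open>g\<close> and lifts it above \<open>r\<close> at \<open>v\<close>. An affine minorant exists because
      a point \<open>(v0, s0 - 1)\<close> just below the graph cannot be cut off by a vertical hyperplane.\<close>
    have "ereal (s0 - 1) < g v0" using s0 by simp
    then obtain p1 q1 c1 where v0: "p1 \<bullet> v0 + q1 * (s0 - 1) < c1"
      and H1: "\<forall>w s. g w \<le> ereal s \<longrightarrow> c1 < p1 \<bullet> w + q1 * s"
      using sep by blast
    have "c1 < p1 \<bullet> v0 + q1 * s0" using H1 s0 by simp
    with v0 have q1: "0 < q1" by (simp add: right_diff_distrib)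
    define a1 where "a1 = - (1 / q1) *\<^sub>R p1"
    define b1 where "b1 = c1 / q1"
    have below: "ereal (a1 \<bullet> w + b1) \<le> g w" for w
      using minorant[OF q1 H1] by (simp add: a1_def b1_def)
    define d where "d = c - p \<bullet> v"
    have d: "0 < d" using v True by (simp add: d_def)
    define l where "l = (\<bar>r - (a1 \<bullet> v + b1)\<bar> + 1) / d"
    have l: "0 \<le> l" "l * d = \<bar>r - (a1 \<bullet> v + b1)\<bar> + 1"
      using d by (auto simp: l_def)
    have "ereal ((a1 - l *\<^sub>R p) \<bullet> w + (b1 + l * c)) \<le> g w" for w
    proof (cases "g w = \<infinity>")
      case False
      then obtain s where s: "g w = ereal s" using dom by blast
      then have "c < p \<bullet> w + q * s" using H by simp
      then have "c \<le> p \<bullet> w" using True by simp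
      then have "l * c \<le> l * (p \<bullet> w)" using l(1) by (rule mult_left_mono)
      moreover have "a1 \<bullet> w + b1 \<le> s" using below[of w] s by simp
      ultimately show ?thesis using s by (simp add: inner_diff_left)
    qed simp
    moreover have "r < (a1 - l *\<^sub>R p) \<bullet> v + (b1 + l * c)"
      using l(2) by (simp add: d_def inner_diff_left right_diff_distrib)
    ultimately show ?thesis by blast
  qed
qed

text \<open>
  Countability comes from restricting slope and offset to a countable dense set. On a bounded
  effective domain a small change of slope changes an affine function by a uniformly small amount,
  which a slightly smaller offset compensates; hence the affine minorants that exceed \<open>r\<close> at \<open>v\<close>
  contain a nonempty open set of parameters as soon as there is one of them.
\<close>

lemma countable_affine_supremum:
  fixes g :: "'a::euclidean_space \<Rightarrow> ereal"
  assumes g: "proper_fun g" "convex_fun g" "lsc_fun g"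
    and bdd: "bounded (effective_domain g)"
  obtains a :: "nat \<Rightarrow> 'a" and b :: "nat \<Rightarrow> real"
  where "\<And>w. g w = (SUP i. ereal (a i \<bullet> w + b i))"
proof -
  obtain R where R: "\<And>w. g w < \<infinity> \<Longrightarrow> norm w \<le> R"
    using bdd by (auto simp: bounded_iff effective_domain_def)
  obtain D :: "('a \<times> real) set" where D: "countable D"
    "\<And>X. open X \<Longrightarrow> X \<noteq> {} \<Longrightarrow> \<exists>d\<in>D. d \<in> X"
    using countable_dense_setE by blast
  define N where "N = {p \<in> D. \<forall>w. ereal (fst p \<bullet> w + snd p) \<le> g w}"
  have above: "\<exists>p\<in>N. r < fst p \<bullet> v + snd p" if r: "ereal r < g v" for r v
  proof -
    obtain a0 b0 where ab: "\<And>w. ereal (a0 \<bullet> w + b0) \<le> g w" "r < a0 \<bullet> v + b0"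
      using affine_minorant_above[OF g r] by blast
    \<comment> \<open>The second condition says that the loss in offset outweighs the largest gain that the
      change of slope can cause on the ball of radius \<open>R\<close>.\<close>
    define X where "X = {p :: 'a \<times> real. r < fst p \<bullet> v + snd p} \<inter>
      {p. norm (fst p - a0) * R < b0 - snd p}"
    have "open X"
      unfolding X_def by (intro open_Int open_Collect_less continuous_intros)
    moreover have "(a0, b0 - (a0 \<bullet> v + b0 - r) / 2) \<in> X"
      using ab(2) by (simp add: X_def field_simps)
    ultimately obtain p where p: "p \<in> D" "p \<in> X"
      using D(2) by blast
    have "ereal (fst p \<bullet> w + snd p) \<le> g w" for w
    proof (cases "g w = \<infinity>")
      case False
      then have "norm w \<le> R" using R by (simp add: less_top)
      have "(fst p - a0) \<bullet> w \<le> norm (fst p - a0) * norm w"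
        by (rule norm_cauchy_schwarz)
      also have "\<dots> \<le> norm (fst p - a0) * R"
        using \<open>norm w \<le> R\<close> by (intro mult_left_mono) auto
      also have "\<dots> < b0 - snd p"
        using p(2) by (simp add: X_def)
      finally have "fst p \<bullet> w + snd p \<le> a0 \<bullet> w + b0"
        by (simp add: inner_diff_left)
      then show ?thesis
        using ab(1)[of w] by (meson ereal_less_eq(3) order_trans)
    qed simp
    with p have "p \<in> N" "r < fst p \<bullet> v + snd p"
      by (simp_all add: N_def X_def)
    then show ?thesis by blast
  qed
  obtain v0 s0 where "g v0 = ereal s0"
    using g(1) unfolding proper_fun_def by (metis ereal_cases)
  then have "N \<noteq> {}" using above[of "s0 - 1" v0] by auto
  moreover have "countable N" using D(1) by (simp add: N_def)
  ultimately have range: "range (from_nat_into N) = N"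
    by (rule range_from_nat_into)
  have "g w = (SUP i. ereal (fst (from_nat_into N i) \<bullet> w + snd (from_nat_into N i)))" for w
  proof (rule antisym)
    show "g w \<le> (SUP i. ereal (fst (from_nat_into N i) \<bullet> w + snd (from_nat_into N i)))"
    proof (rule dense_le)
      fix y assume "y < g w"
      then obtain r where r: "y < ereal r" "ereal r < g w"
        using ereal_dense2 by blast
      then obtain i where "r < fst (from_nat_into N i) \<bullet> w + snd (from_nat_into N i)"
        using above range by (metis imageE)
      then have "ereal r \<le> ereal (fst (from_nat_into N i) \<bullet> w + snd (from_nat_into N i))"
        by simp
      also have "\<dots> \<le> (SUP i. ereal (fst (from_nat_into N i) \<bullet> w + snd (from_nat_into N i)))"
        by (rule SUP_upper) simp
      finally show "y \<le> (SUP i. ereal (fst (from_nat_into N i) \<bullet> w + snd (from_nat_into N i)))"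
        using r(1) by simp
    qed
    have "from_nat_into N i \<in> N" for i using range by blast
    then show "(SUP i. ereal (fst (from_nat_into N i) \<bullet> w + snd (from_nat_into N i))) \<le> g w"
      by (intro SUP_least) (auto simp: N_def)
  qed
  then show ?thesis by (rule that)
qed

section \<open>Finite maxima of affine functions\<close>

definition affine_max :: "(nat \<Rightarrow> 'a::real_inner) \<Rightarrow> (nat \<Rightarrow> real) \<Rightarrow> nat \<Rightarrow> 'a \<Rightarrow> real" where
  "affine_max a b k w = (MAX i\<in>{..k}. a i \<bullet> w + b i)"

lemma affine_max_0: "affine_max a b 0 w = a 0 \<bullet> w + b 0"
  by (simp add: affine_max_def)

lemma affine_max_Suc: "affine_max a b (Suc k) w = max (a (Suc k) \<bullet> w + b (Suc k)) (affine_max a b k w)"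
  by (simp add: affine_max_def atMost_Suc)

lemma affine_max_mono: "k \<le> l \<Longrightarrow> affine_max a b k w \<le> affine_max a b l w"
  unfolding affine_max_def by (intro Max_mono) auto

lemma SUP_affine_max:
  "(SUP k. ereal (affine_max a b k w)) = (SUP i. ereal (a i \<bullet> w + b i))"
proof (rule antisym)
  show "(SUP k. ereal (affine_max a b k w)) \<le> (SUP i. ereal (a i \<bullet> w + b i))"
  proof (rule SUP_least)
    fix k
    have "affine_max a b k w \<in> (\<lambda>i. a i \<bullet> w + b i) ` {..k}"
      unfolding affine_max_def by (rule Max_in) auto
    then obtain i where "affine_max a b k w = a i \<bullet> w + b i" by blast
    then show "ereal (affine_max a b k w) \<le> (SUP i. ereal (a i \<bullet> w + b i))"
      by (auto intro: SUP_upper)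
  qed
  have "a i \<bullet> w + b i \<le> affine_max a b i w" for i
    unfolding affine_max_def by (intro Max_ge) auto
  then show "(SUP i. ereal (a i \<bullet> w + b i)) \<le> (SUP k. ereal (affine_max a b k w))"
    by (intro SUP_mono) auto
qed

text \<open>
  A measurable subgradient selection: \<open>p x\<close> and \<open>q x\<close> are the coefficients of one of the finitely many
  affine functions that attains the maximum at \<open>u x\<close>. Induction on \<open>k\<close> makes the selection by
  comparing the new function with the maximum so far, so that measurability is immediate.
  The coefficients are bounded because only finitely many occur.
\<close>

lemma measurable_active_affine:
  fixes a :: "nat \<Rightarrow> 'a::euclidean_space"
  assumes [measurable]: "u \<in> borel_measurable N"
  shows "\<exists>p q P Q. p \<in> borel_measurable N \<and> q \<in> borel_measurable N \<and>
    (\<forall>x. norm (p x) \<le> (P::real)) \<and> (\<forall>x. \<bar>q x\<bar> \<le> (Q::real)) \<and>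
    (\<forall>x. affine_max a b k (u x) = p x \<bullet> u x + q x) \<and>
    (\<forall>x w. p x \<bullet> w + q x \<le> affine_max a b k w)"
proof (induction k)
  case 0
  show ?case
    by (rule exI[of _ "\<lambda>_. a 0"], rule exI[of _ "\<lambda>_. b 0"]) (auto simp: affine_max_0)
next
  case (Suc k)
  then obtain p q P Q where [measurable]: "p \<in> borel_measurable N" "q \<in> borel_measurable N"
    and bnd: "\<And>x. norm (p x) \<le> P" "\<And>x. \<bar>q x\<bar> \<le> Q"
    and eq: "\<And>x. affine_max a b k (u x) = p x \<bullet> u x + q x"
    and le: "\<And>x w. p x \<bullet> w + q x \<le> affine_max a b k w"
    by blast
  let ?c = "\<lambda>x. p x \<bullet> u x + q x < a (Suc k) \<bullet> u x + b (Suc k)"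
  let ?p = "\<lambda>x. if ?c x then a (Suc k) else p x"
  let ?q = "\<lambda>x. if ?c x then b (Suc k) else q x"
  have "?p \<in> borel_measurable N" "?q \<in> borel_measurable N" by measurable
  moreover have "norm (?p x) \<le> max P (norm (a (Suc k)))" for x
    using bnd(1)[of x] by auto
  moreover have "\<bar>?q x\<bar> \<le> max Q \<bar>b (Suc k)\<bar>" for x
    using bnd(2)[of x] by auto
  moreover have "affine_max a b (Suc k) (u x) = ?p x \<bullet> u x + ?q x" for x
    by (simp add: affine_max_Suc eq)
  moreover have "?p x \<bullet> w + ?q x \<le> affine_max a b (Suc k) w" for x w
    using le[of x w] by (simp add: affine_max_Suc max.coboundedI2)
  ultimately show ?case by blast
qed

section \<open>Integrals of extended real functions\<close>

lemma ereal_integral_mono: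
  "(\<And>x. h x \<le> h' x) \<Longrightarrow> ereal_integral N h \<le> ereal_integral N h'"
  unfolding ereal_integral_def
  by (intro ereal_minus_mono) (auto simp: less_eq_ennreal.rep_eq[symmetric] intro!: nn_integral_mono e2ennreal_mono)

lemma ereal_integral_real:
  assumes "integrable N f"
  shows "ereal_integral N (\<lambda>x. ereal (f x)) = ereal (\<integral>x. f x \<partial>N)"
proof -
  have "(\<integral>\<^sup>+x. ennreal (f x) \<partial>N) \<noteq> \<infinity>" "(\<integral>\<^sup>+x. ennreal (- f x) \<partial>N) \<noteq> \<infinity>"
    using assms by (auto simp: real_integrable_def)
  moreover have "enn2ereal y = ereal (enn2real y)" if "y \<noteq> \<infinity>" for y
    using that by (cases y) (auto simp: enn2ereal_ennreal)
  ultimately show ?thesis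
    using assms by (simp add: ereal_integral_def real_lebesgue_integral_def)
qed

text \<open>
  The positive parts increase, so monotone convergence applies to them. The negative parts decrease
  and are dominated by the integrable negative part of \<open>f 0\<close>; their limit is therefore finite and the
  difference of the two limits is meaningful, even if the integral of the positive part is infinite.
\<close>

lemma ereal_integral_monotone_convergence:
  fixes f :: "nat \<Rightarrow> 'a \<Rightarrow> real"
  assumes int: "\<And>k. integrable N (f k)"
    and mono: "\<And>k l x. k \<le> l \<Longrightarrow> f k x \<le> f l x"
    and h: "\<And>x. h x = (SUP k. ereal (f k x))"
  shows "(\<lambda>k. ereal (\<integral>x. f k x \<partial>N)) \<longlonglongrightarrow> ereal_integral N h"
proof -
  have [measurable]: "f k \<in> borel_measurable N" for k
    using int by auto
  have [measurable]: "h \<in> borel_measurable N"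
    unfolding h[abs_def] by measurable
  have lim: "(\<lambda>k. ereal (f k x)) \<longlonglongrightarrow> h x" for x
    unfolding h by (rule LIMSEQ_SUP) (auto simp: incseq_def mono)
  have pos: "(\<lambda>k. \<integral>\<^sup>+x. e2ennreal (ereal (f k x)) \<partial>N) \<longlonglongrightarrow> (\<integral>\<^sup>+x. e2ennreal (h x) \<partial>N)"
    by (rule nn_integral_LIMSEQ)
      (auto simp: incseq_def le_fun_def intro!: mono ennreal_leI tendsto_e2ennrealI lim
            simp del: e2ennreal_ereal intro: e2ennreal_mono)
  have fin: "(\<integral>\<^sup>+x. ennreal (- f 0 x) \<partial>N) < \<infinity>"
    using int[of 0] by (simp add: real_integrable_def less_top)
  have neg: "(\<lambda>k. \<integral>\<^sup>+x. e2ennreal (- ereal (f k x)) \<partial>N) \<longlonglongrightarrow> (\<integral>\<^sup>+x. e2ennreal (- h x) \<partial>N)"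
  proof (rule nn_integral_dominated_convergence[where w = "\<lambda>x. ennreal (- f 0 x)"])
    show "AE x in N. (\<lambda>k. e2ennreal (- ereal (f k x))) \<longlonglongrightarrow> e2ennreal (- h x)"
      by (intro AE_I2 tendsto_e2ennrealI tendsto_uminus_ereal lim)
  qed (use fin in \<open>auto intro!: ennreal_leI mono\<close>)
  have "- h x \<le> - ereal (f 0 x)" for x
    unfolding h ereal_minus_le_minus by (rule SUP_upper) simp
  then have "(\<integral>\<^sup>+x. e2ennreal (- h x) \<partial>N) \<le> (\<integral>\<^sup>+x. ennreal (- f 0 x) \<partial>N)"
    by (intro nn_integral_mono) (metis e2ennreal_ereal e2ennreal_mono uminus_ereal.simps(1))
  then have "(\<integral>\<^sup>+x. e2ennreal (- h x) \<partial>N) \<noteq> \<infinity>"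
    using fin by (auto simp: less_top[symmetric] top_unique)
  then have "enn2ereal (\<integral>\<^sup>+x. e2ennreal (- h x) \<partial>N) \<noteq> \<infinity>"
    by (metis e2ennreal_enn2ereal e2ennreal_infty infinity_ennreal_def)
  then have "(\<lambda>k. ereal_integral N (\<lambda>x. ereal (f k x))) \<longlonglongrightarrow> ereal_integral N h"
    unfolding ereal_integral_def
    by (intro tendsto_diff_ereal_general tendsto_enn2erealI pos neg) auto
  then show ?thesis
    by (simp add: ereal_integral_real int)
qed

section \<open>Integral functionals on square integrable fields\<close>

lemma L2_integrable_norm:
  assumes "finite_measure (lebesgue_on \<Omega>)" and u: "u \<in> L2 \<Omega>"
  shows "integrable (lebesgue_on \<Omega>) (\<lambda>x. norm (u x))"
proof (rule finite_measure.square_integrable_imp_integrable[OF assms(1)])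
  have [measurable]: "u \<in> borel_measurable (lebesgue_on \<Omega>)" using u by (simp add: L2_def)
  show "(\<lambda>x. norm (u x)) \<in> borel_measurable (lebesgue_on \<Omega>)" by measurable
  show "integrable (lebesgue_on \<Omega>) (\<lambda>x. (norm (u x))\<^sup>2)" using u by (simp add: L2_def)
qed

text \<open>
  The Cauchy-Schwarz inequality for \<open>norm \<circ> u\<close> and the constant one, obtained from the nonnegativity of
  the variance of \<open>norm \<circ> u\<close>.
\<close>

lemma L2_integral_norm_le:
  assumes fin: "finite_measure (lebesgue_on \<Omega>)" and u: "u \<in> L2 \<Omega>"
  shows "(\<integral>x. norm (u x) \<partial>lebesgue_on \<Omega>)
           \<le> sqrt (measure (lebesgue_on \<Omega>) (space (lebesgue_on \<Omega>))) * L2_norm \<Omega> u"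
proof -
  interpret finite_measure "lebesgue_on \<Omega>" by fact
  let ?N = "lebesgue_on \<Omega>"
  let ?\<mu> = "measure ?N (space ?N)"
  let ?I = "\<integral>x. norm (u x) \<partial>?N" and ?J = "\<integral>x. (norm (u x))\<^sup>2 \<partial>?N"
  have [measurable]: "u \<in> borel_measurable ?N" and int2: "integrable ?N (\<lambda>x. (norm (u x))\<^sup>2)"
    using u by (auto simp: L2_def)
  note int1 = L2_integrable_norm[OF fin u]
  have "?I\<^sup>2 \<le> ?\<mu> * ?J"
  proof (cases "?\<mu> = 0")
    case True
    then have "emeasure ?N (space ?N) = 0"
      by (simp add: emeasure_eq_measure)
    then have "AE x in ?N. norm (u x) = 0"
      by (intro AE_I[of _ _ "space ?N"]) auto
    then have "?I = 0" by (rule integral_eq_zero_AE)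
    then show ?thesis by (simp add: True)
  next
    case False
    then have \<mu>: "0 < ?\<mu>" by (simp add: zero_less_measure_iff)
    define m where "m = ?I / ?\<mu>"
    have "0 \<le> (\<integral>x. (norm (u x) - m)\<^sup>2 \<partial>?N)" by simp
    also have "(\<lambda>x. (norm (u x) - m)\<^sup>2) = (\<lambda>x. (norm (u x))\<^sup>2 - (2 * m) * norm (u x) + m\<^sup>2)"
      by (auto simp: power2_diff)
    also have "(\<integral>x. (norm (u x))\<^sup>2 - (2 * m) * norm (u x) + m\<^sup>2 \<partial>?N) = ?J - 2 * m * ?I + m\<^sup>2 * ?\<mu>"
      using int1 int2 by (simp add: mult.commute)
    also have "\<dots> = ?J - ?I\<^sup>2 / ?\<mu>"
      using \<mu> by (simp add: m_def power2_eq_square field_simps)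
    finally show ?thesis using \<mu> by (simp add: field_simps)
  qed
  then have "sqrt (?I\<^sup>2) \<le> sqrt (?\<mu> * ?J)" by (rule real_sqrt_le_mono)
  then show ?thesis by (simp add: L2_norm_def real_sqrt_mult)
qed

lemma integrable_inner_L2:
  fixes u :: "real^'n \<Rightarrow> real^'m"
  assumes fin: "finite_measure (lebesgue_on \<Omega>)" and u: "u \<in> L2 \<Omega>"
    and [measurable]: "p \<in> borel_measurable (lebesgue_on \<Omega>)" and P: "\<And>x. norm (p x) \<le> P"
  shows "integrable (lebesgue_on \<Omega>) (\<lambda>x. p x \<bullet> u x)"
proof (rule Bochner_Integration.integrable_bound)
  have [measurable]: "u \<in> borel_measurable (lebesgue_on \<Omega>)" using u by (simp add: L2_def)
  show "integrable (lebesgue_on \<Omega>) (\<lambda>x. P * norm (u x))"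
    using L2_integrable_norm[OF fin u] by simp
  show "(\<lambda>x. p x \<bullet> u x) \<in> borel_measurable (lebesgue_on \<Omega>)" by measurable
  have "norm (p x \<bullet> u x) \<le> norm (P * norm (u x))" for x
    using Cauchy_Schwarz_ineq2[of "p x" "u x"] mult_right_mono[OF P[of x] norm_ge_zero[of "u x"]]
    by (simp only: real_norm_def)
  then show "AE x in lebesgue_on \<Omega>. norm (p x \<bullet> u x) \<le> norm (P * norm (u x))" by simp
qed

lemma bounded_field_in_L2_dual:
  fixes p :: "real^'n \<Rightarrow> real^'m"
  assumes fin: "finite_measure (lebesgue_on \<Omega>)"
    and p: "p \<in> borel_measurable (lebesgue_on \<Omega>)" and P: "\<And>x. norm (p x) \<le> P"
  shows "(\<lambda>u. \<integral>x. p x \<bullet> u x \<partial>lebesgue_on \<Omega>) \<in> L2_dual \<Omega>"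
proof -
  let ?N = "lebesgue_on \<Omega>"
  note int = integrable_inner_L2[OF fin _ p P]
  have P0: "0 \<le> P" using P[of undefined] norm_ge_zero order_trans by blast
  have "\<bar>\<integral>x. p x \<bullet> u x \<partial>?N\<bar> \<le> P * sqrt (measure ?N (space ?N)) * L2_norm \<Omega> u"
    if u: "u \<in> L2 \<Omega>" for u :: "real^'n \<Rightarrow> real^'m"
  proof -
    have pointwise: "\<bar>p x \<bullet> u x\<bar> \<le> P * norm (u x)" for x
      using Cauchy_Schwarz_ineq2[of "p x" "u x"] mult_right_mono[OF P[of x] norm_ge_zero[of "u x"]]
      by linarith
    have "\<bar>\<integral>x. p x \<bullet> u x \<partial>?N\<bar> \<le> (\<integral>x. \<bar>p x \<bullet> u x\<bar> \<partial>?N)"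
      by (rule integral_abs_bound)
    also have "\<dots> \<le> (\<integral>x. P * norm (u x) \<partial>?N)"
      using int[OF u] L2_integrable_norm[OF fin u]
      by (intro integral_mono pointwise) auto
    also have "\<dots> = P * (\<integral>x. norm (u x) \<partial>?N)" by simp
    also have "\<dots> \<le> P * (sqrt (measure ?N (space ?N)) * L2_norm \<Omega> u)"
      by (intro mult_left_mono L2_integral_norm_le fin u P0)
    finally show ?thesis by (simp add: mult.assoc)
  qed
  then show ?thesis
    unfolding L2_dual_def by (auto simp: inner_add_right int)
qed

lemma integrable_affine_max:
  assumes fin: "finite_measure (lebesgue_on \<Omega>)" and u: "u \<in> L2 \<Omega>"
  shows "integrable (lebesgue_on \<Omega>) (\<lambda>x. affine_max a b k (u x))"
proof -
  interpret finite_measure "lebesgue_on \<Omega>" by fact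
  have "u \<in> borel_measurable (lebesgue_on \<Omega>)" using u by (simp add: L2_def)
  from measurable_active_affine[OF this, of a b k] obtain p q P Q where
    p: "p \<in> borel_measurable (lebesgue_on \<Omega>)" "\<And>x. norm (p x) \<le> P" and
    q: "q \<in> borel_measurable (lebesgue_on \<Omega>)" "\<And>x. \<bar>q x\<bar> \<le> Q" and
    eq: "\<And>x. affine_max a b k (u x) = p x \<bullet> u x + q x" by blast
  have "integrable (lebesgue_on \<Omega>) q"
    using q by (intro integrable_const_bound[of _ Q]) auto
  then show ?thesis
    unfolding eq using integrable_inner_L2[OF fin u p] by simp
qed

text \<open>
  The active coefficients are chosen for the limit \<open>u\<close> and kept fixed along the sequence: they give a
  lower bound for every \<open>us n\<close> that is weakly continuous and sharp at \<open>u\<close>.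
\<close>

lemma affine_max_integral_weak_lsc:
  assumes fin: "finite_measure (lebesgue_on \<Omega>)" and conv: "L2_weak_conv \<Omega> us u"
  shows "ereal (\<integral>x. affine_max a b k (u x) \<partial>lebesgue_on \<Omega>)
           \<le> liminf (\<lambda>n. ereal (\<integral>x. affine_max a b k (us n x) \<partial>lebesgue_on \<Omega>))"
proof -
  interpret finite_measure "lebesgue_on \<Omega>" by fact
  let ?N = "lebesgue_on \<Omega>"
  have u: "u \<in> L2 \<Omega>" and us: "\<And>n. us n \<in> L2 \<Omega>"
    using conv by (auto simp: L2_weak_conv_def)
  have "u \<in> borel_measurable ?N" using u by (simp add: L2_def)
  from measurable_active_affine[OF this, of a b k] obtain p q P Q where
    p: "p \<in> borel_measurable ?N" "\<And>x. norm (p x) \<le> P" and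
    q: "q \<in> borel_measurable ?N" "\<And>x. \<bar>q x\<bar> \<le> Q" and
    eq: "\<And>x. affine_max a b k (u x) = p x \<bullet> u x + q x" and
    le: "\<And>x w. p x \<bullet> w + q x \<le> affine_max a b k w" by blast
  have intq: "integrable ?N q"
    using q by (intro integrable_const_bound[of _ Q]) auto
  note intp = integrable_inner_L2[OF fin _ p]
  have "(\<lambda>n. \<integral>x. p x \<bullet> us n x \<partial>?N) \<longlonglongrightarrow> (\<integral>x. p x \<bullet> u x \<partial>?N)"
    using conv bounded_field_in_L2_dual[OF fin p] by (auto simp: L2_weak_conv_def)
  then have "(\<lambda>n. ereal ((\<integral>x. p x \<bullet> us n x \<partial>?N) + (\<integral>x. q x \<partial>?N)))
               \<longlonglongrightarrow> ereal ((\<integral>x. p x \<bullet> u x \<partial>?N) + (\<integral>x. q x \<partial>?N))"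
    by (intro tendsto_ereal tendsto_add tendsto_const)
  then have "ereal ((\<integral>x. p x \<bullet> u x \<partial>?N) + (\<integral>x. q x \<partial>?N))
      = liminf (\<lambda>n. ereal ((\<integral>x. p x \<bullet> us n x \<partial>?N) + (\<integral>x. q x \<partial>?N)))"
    by (intro lim_imp_Liminf[symmetric] sequentially_bot)
  also have "\<dots> \<le> liminf (\<lambda>n. ereal (\<integral>x. affine_max a b k (us n x) \<partial>?N))"
  proof (intro Liminf_mono always_eventually allI)
    fix n
    have "(\<integral>x. p x \<bullet> us n x \<partial>?N) + (\<integral>x. q x \<partial>?N) = (\<integral>x. p x \<bullet> us n x + q x \<partial>?N)"
      using intp[OF us] intq by simp
    also have "\<dots> \<le> (\<integral>x. affine_max a b k (us n x) \<partial>?N)"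
      using intp[OF us] intq by (intro integral_mono integrable_affine_max fin us le) auto
    finally show "ereal ((\<integral>x. p x \<bullet> us n x \<partial>?N) + (\<integral>x. q x \<partial>?N))
        \<le> ereal (\<integral>x. affine_max a b k (us n x) \<partial>?N)" by simp
  qed
  also have "(\<integral>x. p x \<bullet> u x \<partial>?N) + (\<integral>x. q x \<partial>?N) = (\<integral>x. affine_max a b k (u x) \<partial>?N)"
    unfolding eq using intp[OF u] intq by simp
  finally show ?thesis .
qed

lemma affine_max_integral_below:
  assumes fin: "finite_measure (lebesgue_on \<Omega>)" and v: "v \<in> L2 \<Omega>"
    and le: "\<And>w. ereal (affine_max a b k w) \<le> g w"
  shows "ereal (\<integral>x. affine_max a b k (v x) \<partial>lebesgue_on \<Omega>)
           \<le> ereal_integral (lebesgue_on \<Omega>) (\<lambda>x. g (v x))"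
proof -
  have "ereal (\<integral>x. affine_max a b k (v x) \<partial>lebesgue_on \<Omega>)
      = ereal_integral (lebesgue_on \<Omega>) (\<lambda>x. ereal (affine_max a b k (v x)))"
    by (simp add: ereal_integral_real integrable_affine_max fin v)
  also have "\<dots> \<le> ereal_integral (lebesgue_on \<Omega>) (\<lambda>x. g (v x))"
    by (intro ereal_integral_mono le)
  finally show ?thesis .
qed

text \<open>
  Integrating a single affine minorant gives a finite lower bound. With it the lower limit of the
  integral term stays above \<open>-\<infinity>\<close>, so that the lower limits of the two terms of the energy add up.
\<close>

lemma convex_integral_not_MInfty:
  fixes g :: "real^'m \<Rightarrow> ereal"
  assumes fin: "finite_measure (lebesgue_on \<Omega>)"
    and g: "proper_fun g" "convex_fun g" "lsc_fun g" "bounded (effective_domain g)"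
    and u: "u \<in> L2 \<Omega>"
  shows "ereal_integral (lebesgue_on \<Omega>) (\<lambda>x. g (u x)) \<noteq> -\<infinity>"
proof -
  obtain a :: "nat \<Rightarrow> real^'m" and b where "\<And>w. g w = (SUP i. ereal (a i \<bullet> w + b i))"
    using countable_affine_supremum[OF g] by blast
  then have "ereal (affine_max a b 0 w) \<le> g w" for w
    unfolding affine_max_0 by (auto intro: SUP_upper)
  from affine_max_integral_below[OF fin u this] show ?thesis by auto
qed

text \<open>
  The lower bound is proved for each finite maximum of affine functions separately. The limit in
  the number of functions is taken last and only at the weak limit \<open>u\<close>, where monotone convergence
  applies; along the sequence \<open>\<phi>\<^sub>k \<le> g\<close> suffices.
\<close>

lemma convex_integral_weak_lsc:
  fixes g :: "real^'m \<Rightarrow> ereal"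
  assumes fin: "finite_measure (lebesgue_on \<Omega>)"
    and g: "proper_fun g" "convex_fun g" "lsc_fun g" "bounded (effective_domain g)"
    and conv: "L2_weak_conv \<Omega> us u"
  shows "ereal_integral (lebesgue_on \<Omega>) (\<lambda>x. g (u x))
           \<le> liminf (\<lambda>n. ereal_integral (lebesgue_on \<Omega>) (\<lambda>x. g (us n x)))"
proof -
  let ?N = "lebesgue_on \<Omega>"
  obtain a :: "nat \<Rightarrow> real^'m" and b where "\<And>w. g w = (SUP i. ereal (a i \<bullet> w + b i))"
    using countable_affine_supremum[OF g] by blast
  then have sup: "\<And>w. g w = (SUP k. ereal (affine_max a b k w))"
    by (simp add: SUP_affine_max)
  then have le: "\<And>k w. ereal (affine_max a b k w) \<le> g w"
    by (auto intro: SUP_upper)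
  have u: "u \<in> L2 \<Omega>" and us: "\<And>n. us n \<in> L2 \<Omega>"
    using conv by (auto simp: L2_weak_conv_def)
  have lim: "(\<lambda>k. ereal (\<integral>x. affine_max a b k (u x) \<partial>?N)) \<longlonglongrightarrow> ereal_integral ?N (\<lambda>x. g (u x))"
    by (rule ereal_integral_monotone_convergence)
      (auto simp: sup intro: integrable_affine_max fin u affine_max_mono)
  show ?thesis
  proof (rule LIMSEQ_le_const2[OF lim], intro exI allI impI)
    fix k
    have "ereal (\<integral>x. affine_max a b k (u x) \<partial>?N)
        \<le> liminf (\<lambda>n. ereal (\<integral>x. affine_max a b k (us n x) \<partial>?N))"
      by (rule affine_max_integral_weak_lsc[OF fin conv])
    also have "\<dots> \<le> liminf (\<lambda>n. ereal_integral ?N (\<lambda>x. g (us n x)))"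
      by (intro Liminf_mono always_eventually allI affine_max_integral_below fin us le)
    finally show "ereal (\<integral>x. affine_max a b k (u x) \<partial>?N)
        \<le> liminf (\<lambda>n. ereal_integral ?N (\<lambda>x. g (us n x)))" .
  qed
qed

section \<open>The tracking term and the Gamma-limit\<close>

text \<open>
  Expanding \<open>\<parallel>(y\<^sub>n - z\<^sub>n) - d\<parallel>\<^sup>2 \<ge> 0\<close> with \<open>d = y - z\<close> bounds the right-hand side from below by
  affine functions of \<open>y\<^sub>n - z\<^sub>n\<close>, along which weak convergence of \<open>y\<^sub>n\<close> and strong convergence
  of \<open>z\<^sub>n\<close> pass to the limit.
\<close>

lemma weak_lsc_half_norm_squared:
  fixes y :: "'y::real_inner"
  assumes weak: "weak_conv ys y" and zs: "zs \<longlonglongrightarrow> z"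
  shows "ereal (1 / 2 * (norm (y - z))\<^sup>2) \<le> liminf (\<lambda>n. ereal (1 / 2 * (norm (ys n - zs n))\<^sup>2))"
proof -
  let ?d = "y - z"
  have "(\<lambda>n. ?d \<bullet> ys n) \<longlonglongrightarrow> ?d \<bullet> y"
    using weak bounded_linear_inner_right[of ?d] by (auto simp: weak_conv_def)
  moreover have "(\<lambda>n. ?d \<bullet> zs n) \<longlonglongrightarrow> ?d \<bullet> z"
    by (intro tendsto_inner tendsto_const zs)
  ultimately have "(\<lambda>n. ?d \<bullet> ys n - ?d \<bullet> zs n - 1 / 2 * (norm ?d)\<^sup>2)
      \<longlonglongrightarrow> ?d \<bullet> y - ?d \<bullet> z - 1 / 2 * (norm ?d)\<^sup>2"
    by (intro tendsto_diff tendsto_const)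
  also have "?d \<bullet> y - ?d \<bullet> z - 1 / 2 * (norm ?d)\<^sup>2 = 1 / 2 * (norm ?d)\<^sup>2"
    by (simp only: power2_norm_eq_inner inner_diff_right) (simp add: field_simps)
  finally have "(\<lambda>n. ereal (?d \<bullet> ys n - ?d \<bullet> zs n - 1 / 2 * (norm ?d)\<^sup>2))
      \<longlonglongrightarrow> ereal (1 / 2 * (norm ?d)\<^sup>2)" by simp
  then have "ereal (1 / 2 * (norm ?d)\<^sup>2)
      = liminf (\<lambda>n. ereal (?d \<bullet> ys n - ?d \<bullet> zs n - 1 / 2 * (norm ?d)\<^sup>2))"
    by (intro lim_imp_Liminf[symmetric] sequentially_bot)
  also have "\<dots> \<le> liminf (\<lambda>n. ereal (1 / 2 * (norm (ys n - zs n))\<^sup>2))"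
  proof (intro Liminf_mono always_eventually allI)
    fix n
    have "0 \<le> (norm ((ys n - zs n) - ?d))\<^sup>2" by simp
    also have "\<dots> = (norm (ys n - zs n))\<^sup>2 - 2 * (?d \<bullet> (ys n - zs n)) + (norm ?d)\<^sup>2"
      by (simp only: power2_norm_eq_inner inner_diff_left inner_diff_right inner_commute) simp
    finally show "ereal (?d \<bullet> ys n - ?d \<bullet> zs n - 1 / 2 * (norm ?d)\<^sup>2)
        \<le> ereal (1 / 2 * (norm (ys n - zs n))\<^sup>2)"
      by (simp add: inner_diff_right)
  qed
  finally show ?thesis .
qed

theorem proposition3p1:
  fixes \<Omega> :: "(real^'n) set"
    and S :: "(real^'n \<Rightarrow> real^'m) \<Rightarrow> 'y::{real_inner, complete_space}"
    and M :: "(real^'m) set"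
    and g :: "real^'m \<Rightarrow> ereal"
    and zs :: "nat \<Rightarrow> 'y" and z :: 'y
  assumes "open \<Omega>" and "bounded \<Omega>"
    and "CARD('m) \<ge> 2"
    and "L2_operator \<Omega> S"
    and "finite M"
    and "proper_fun g" and "convex_fun g" and "lsc_fun g"
    and "effective_domain g = convex hull M"
    and "zs \<longlonglongrightarrow> z"
    and "weak_to_weak_continuous \<Omega> S"
  shows "is_Gamma_limit (L2 \<Omega>) (L2_weak_conv \<Omega>) (\<lambda>n. energy \<Omega> S g (zs n)) (energy \<Omega> S g z)"
  unfolding is_Gamma_limit_def
proof (intro conjI allI impI ballI)
  let ?G = "\<lambda>u. ereal_integral (lebesgue_on \<Omega>) (\<lambda>x. g (u x))"
  let ?T = "\<lambda>n u. ereal (1 / 2 * (norm (S u - zs n))\<^sup>2)"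
  have fin: "finite_measure (lebesgue_on \<Omega>)"
    using assms(1,2) by (intro finite_measure_lebesgue_on lmeasurable_open)
  have bdd: "bounded (effective_domain g)"
    using assms(5,9) by (simp add: bounded_convex_hull finite_imp_bounded)
  {
    fix us :: "nat \<Rightarrow> real^'n \<Rightarrow> real^'m" and u :: "real^'n \<Rightarrow> real^'m"
    assume conv: "L2_weak_conv \<Omega> us u"
    then have u: "u \<in> L2 \<Omega>" by (simp add: L2_weak_conv_def)
    note G = convex_integral_weak_lsc[OF fin assms(6-8) bdd conv]
      and G_not_MInfty = convex_integral_not_MInfty[OF fin assms(6-8) bdd u]
    have "weak_conv (\<lambda>n. S (us n)) (S u)"
      using assms(11) conv by (simp add: weak_to_weak_continuous_def)
    then have T: "ereal (1 / 2 * (norm (S u - z))\<^sup>2) \<le> liminf (\<lambda>n. ?T n (us n))"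
      using assms(10) by (rule weak_lsc_half_norm_squared)
    have "energy \<Omega> S g z u \<le> liminf (\<lambda>n. ?T n (us n)) + liminf (\<lambda>n. ?G (us n))"
      unfolding energy_def by (intro add_mono T G)
    also have "\<dots> \<le> liminf (\<lambda>n. ?T n (us n) + ?G (us n))"
      using T G G_not_MInfty by (intro ereal_liminf_add_mono) auto
    finally show "energy \<Omega> S g z u \<le> liminf (\<lambda>n. energy \<Omega> S g (zs n) (us n))"
      by (simp add: energy_def)
  }
  fix u :: "real^'n \<Rightarrow> real^'m"
  assume u: "u \<in> L2 \<Omega>"
  then have conv: "L2_weak_conv \<Omega> (\<lambda>n. u) u"
    by (simp add: L2_weak_conv_def)
  have "(\<lambda>n. ?T n u) \<longlonglongrightarrow> ereal (1 / 2 * (norm (S u - z))\<^sup>2)"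
    by (intro tendsto_intros assms(10))
  then have "(\<lambda>n. ?T n u + ?G u) \<longlonglongrightarrow> ereal (1 / 2 * (norm (S u - z))\<^sup>2) + ?G u"
    using convex_integral_not_MInfty[OF fin assms(6-8) bdd u]
    by (intro tendsto_add_ereal_general) auto
  then have "limsup (\<lambda>n. energy \<Omega> S g (zs n) u) \<le> energy \<Omega> S g z u"
    unfolding energy_def by (simp add: lim_imp_Limsup)
  with u conv show "\<exists>us. (\<forall>n. us n \<in> L2 \<Omega>) \<and> L2_weak_conv \<Omega> us u \<and>
      limsup (\<lambda>n. energy \<Omega> S g (zs n) (us n)) \<le> energy \<Omega> S g z u"
    by (intro exI[of _ "\<lambda>n. u"]) simp
qed

end
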